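(* Let $\mu\in\mathbb R$, $\mu\neq0$, and let $\mathfrak g_6$ be the six dimensional (solvable, non-nilpotent) real Lie algebra with basis $X_1,\dots,X_6$ whose only nonzero brackets of basis elements (up to skew-symmetry) are $$[X_1,X_2]=-X_5,\qquad [X_1,X_5]=-X_6-\mu X_5,\qquad [X_3,X_4]=-X_6 .$$ Then $\mathfrak g_6$ admits neither symplectic structures nor complex structures, but it admits generalized complex structures of type $1$ and generalized complex structures of type $2$.
   Context: A complex structure on a real Lie algebra $\mathfrak g$ is an endomorphism $j$ with $j^2=-\mathrm{Id}$ and $[x,y]+j[jx,y]+j[x,jy]-[jx,jy]=0$ for all $x,y\in\mathfrak g$. A symplectic structure on $\mathfrak g$ is a nondegenerate skew-symmetric bilinear form $\omega$ with $\omega([x,y],z)+\omega([y,z],x)+\omega([z,x],y)=0$ for all $x,y,z$. A generalized complex structure on $\mathfrak g$ is an endomorphism $\mathcal J$ of $\mathfrak g\oplus\mathfrak g^*$ with $\mathcal J^2=-\mathrm{Id}$, orthogonal with respect to $\langle (x,\alpha),(y,\beta)\rangle=\frac12(\beta(x)+\alpha(y))$, and satisfying $[u,v]+\mathcal J[\mathcal Ju,v]+\mathcal J[u,\mathcal Jv]-[\mathcal Ju,\mathcal Jv]=0$ for all $u,v\in\mathfrak g\oplus\mathfrak g^*$, where $[(x,\alpha),(y,\beta)]=([x,y],-\beta\circ\mathrm{ad}(x)+\alpha\circ\mathrm{ad}(y))$. Write $\mathcal J=\begin{pmatrix}\mathcal J_1&\mathcal J_2\\ \mathcal J_3&\mathcal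 J_4\end{pmatrix}$ with respect to $\mathfrak g\oplus\mathfrak g^*$, so $\mathcal J_2:\mathfrak g^*\to\mathfrak g$. If $\dim\mathfrak g=2n$, $\mathcal J$ is of type $k$ when $\operatorname{rank}(\mathcal J_2)=2(n-k)$. *)

theory Defs
  imports "HOL-Analysis.Analysis"
begin

text \<open>A finite dimensional real Lie algebra is given by a Lie bracket on a Euclidean space; the
  inner product of that space plays no role.\<close>

definition lie_bracket :: "('a::real_vector \<Rightarrow> 'a \<Rightarrow> 'a) \<Rightarrow> bool" where
  "lie_bracket br \<longleftrightarrow> bilinear br \<and> (\<forall>x. br x x = 0) \<and>
     (\<forall>x y z. br x (br y z) + br y (br z x) + br z (br x y) = 0)"

primrec derived_series :: "('a::real_vector \<Rightarrow> 'a \<Rightarrow> 'a) \<Rightarrow> nat \<Rightarrow> 'a set" where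
  "derived_series br 0 = UNIV"
| "derived_series br (Suc m) =
     span {br x y | x y. x \<in> derived_series br m \<and> y \<in> derived_series br m}"

primrec lower_central_series :: "('a::real_vector \<Rightarrow> 'a \<Rightarrow> 'a) \<Rightarrow> nat \<Rightarrow> 'a set" where
  "lower_central_series br 0 = UNIV"
| "lower_central_series br (Suc m) = span {br x y | x y. y \<in> lower_central_series br m}"

definition lie_solvable :: "('a::real_vector \<Rightarrow> 'a \<Rightarrow> 'a) \<Rightarrow> bool" where
  "lie_solvable br \<longleftrightarrow> (\<exists>m. derived_series br m = {0})"

definition lie_nilpotent :: "('a::real_vector \<Rightarrow> 'a \<Rightarrow> 'a) \<Rightarrow> bool" where
  "lie_nilpotent br \<longleftrightarrow> (\<exists>m. lower_central_series br m = {0})"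

definition complex_structure :: "('a::real_vector \<Rightarrow> 'a \<Rightarrow> 'a) \<Rightarrow> ('a \<Rightarrow> 'a) \<Rightarrow> bool" where
  "complex_structure br j \<longleftrightarrow> linear j \<and> (\<forall>x. j (j x) = - x) \<and>
     (\<forall>x y. br x y + j (br (j x) y) + j (br x (j y)) - br (j x) (j y) = 0)"

definition symplectic_structure ::
    "('a::real_vector \<Rightarrow> 'a \<Rightarrow> 'a) \<Rightarrow> ('a \<Rightarrow> 'a \<Rightarrow> real) \<Rightarrow> bool" where
  "symplectic_structure br \<omega> \<longleftrightarrow> bilinear \<omega> \<and> (\<forall>x y. \<omega> x y = - \<omega> y x) \<and>
     (\<forall>x. (\<forall>y. \<omega> x y = 0) \<longrightarrow> x = 0) \<and>
     (\<forall>x y z. \<omega> (br x y) z + \<omega> (br y z) x + \<omega> (br z x) y = 0)"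

text \<open>The dual space is the type of bounded linear functionals: on a Euclidean space every linear
  map is bounded. For the same reason \<^const>\<open>Blinfun\<close> below turns the linear map
  \<open>br x\<close> into a bounded linear map without changing its values.\<close>

type_synonym 'a dual_sum = "'a \<times> ('a \<Rightarrow>\<^sub>L real)"

definition ad :: "('a::euclidean_space \<Rightarrow> 'a \<Rightarrow> 'a) \<Rightarrow> 'a \<Rightarrow> 'a \<Rightarrow>\<^sub>L 'a" where
  "ad br x = Blinfun (br x)"

definition pairing :: "'a::euclidean_space dual_sum \<Rightarrow> 'a dual_sum \<Rightarrow> real" where
  "pairing u v = (blinfun_apply (snd v) (fst u) + blinfun_apply (snd u) (fst v)) / 2"

definition dual_sum_bracket ::
    "('a::euclidean_space \<Rightarrow> 'a \<Rightarrow> 'a) \<Rightarrow> 'a dual_sum \<Rightarrow> 'a dual_sum \<Rightarrow> 'a dual_sum" where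
  "dual_sum_bracket br u v =
     (br (fst u) (fst v), - (snd v o\<^sub>L ad br (fst u)) + (snd u o\<^sub>L ad br (fst v)))"

definition gen_complex_structure ::
    "('a::euclidean_space \<Rightarrow> 'a \<Rightarrow> 'a) \<Rightarrow> ('a dual_sum \<Rightarrow> 'a dual_sum) \<Rightarrow> bool" where
  "gen_complex_structure br J \<longleftrightarrow> linear J \<and> (\<forall>u. J (J u) = - u) \<and>
     (\<forall>u v. pairing (J u) (J v) = pairing u v) \<and>
     (\<forall>u v. dual_sum_bracket br u v + J (dual_sum_bracket br (J u) v)
            + J (dual_sum_bracket br u (J v)) - dual_sum_bracket br (J u) (J v) = 0)"

text \<open>The block of \<open>J\<close> that maps the dual space to the Lie algebra.\<close>

definition block2 :: "('a::euclidean_space dual_sum \<Rightarrow> 'a dual_sum) \<Rightarrow> ('a \<Rightarrow>\<^sub>L real) \<Rightarrow> 'a" where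
  "block2 J \<alpha> = fst (J (0, \<alpha>))"

text \<open>The bound \<open>k \<le> n\<close> only excludes truncated subtraction.\<close>

definition gen_complex_of_type ::
    "('a::euclidean_space \<Rightarrow> 'a \<Rightarrow> 'a) \<Rightarrow> nat \<Rightarrow> ('a dual_sum \<Rightarrow> 'a dual_sum) \<Rightarrow> bool" where
  "gen_complex_of_type br k J \<longleftrightarrow> gen_complex_structure br J \<and>
     (\<exists>n. DIM('a) = 2 * n \<and> k \<le> n \<and> dim (range (block2 J)) = 2 * (n - k))"

text \<open>The standard basis. The index type has six elements, in which the numeral 6 equals 0.\<close>

definition X :: "6 \<Rightarrow> real ^ 6" where
  "X i = axis i 1"

definition g6_bracket :: "real \<Rightarrow> real ^ 6 \<Rightarrow> real ^ 6 \<Rightarrow> real ^ 6" where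
  "g6_bracket \<mu> x y =
     (x $ 1 * y $ 2 - x $ 2 * y $ 1) *\<^sub>R (- X 5) +
     (x $ 1 * y $ 5 - x $ 5 * y $ 1) *\<^sub>R (- X 6 - \<mu> *\<^sub>R X 5) +
     (x $ 3 * y $ 4 - x $ 4 * y $ 3) *\<^sub>R (- X 6)"

end

theory Submission
  imports Defs
begin

text \<open>In the basis \<open>X 1, F, X 3, X 4, E, Z\<close> with \<open>E = X 5 + X 6 / \<mu>\<close>,
  \<open>F = X 2 - X 5 / \<mu> - X 6 / \<mu>\<^sup>2\<close> and \<open>Z = X 6\<close> the brackets become
  \<open>[X 1, E] = - \<mu> E\<close>, \<open>[X 1, F] = Z / \<mu>\<close>, \<open>[X 3, X 4] = - Z\<close>.

  Closedness forces \<open>X 6\<close> into the kernel of every closed 2-form. If \<open>j\<close> were a complex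
  structure, then \<open>ad (j Z)\<close> would commute with \<open>j\<close>. Its image lies in the span of \<open>E, Z\<close>
  and is \<open>j\<close>-invariant. If it is nonzero, it is all of that plane, so \<open>j Z\<close> lies in the plane;
  but then \<open>ad (j Z)\<close> has rank at most one. Hence \<open>j Z\<close> is central, a multiple of
  \<open>Z\<close>, which is impossible.

  The generalized complex structures are block sums, given by the pure spinors
  \<open>exp (i (x\<^sup>* \<and> e\<^sup>* + f\<^sup>* \<and> z\<^sup>*)) \<and> (a\<^sup>* + i b\<^sup>*)\<close> (type 1) and
  \<open>exp (i f\<^sup>* \<and> z\<^sup>*) \<and> (x\<^sup>* + i e\<^sup>*) \<and> (a\<^sup>* + i b\<^sup>*)\<close> (type 2) up to signs, where
  \<open>x\<^sup>*, f\<^sup>*, a\<^sup>*, b\<^sup>*, e\<^sup>*, z\<^sup>*\<close> is the dual basis. They are integrable because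
  \<open>d (f\<^sup>* \<and> z\<^sup>*)\<close> is a multiple of \<open>f\<^sup>* \<and> a\<^sup>* \<and> b\<^sup>*\<close>, which is killed by
  wedging with \<open>a\<^sup>* + i b\<^sup>*\<close>, while \<open>x\<^sup>* \<and> e\<^sup>*\<close> is closed and
  \<open>d (x\<^sup>* + i e\<^sup>*)\<close> is a multiple of \<open>x\<^sup>* \<and> (x\<^sup>* + i e\<^sup>*)\<close>.\<close>

section \<open>Coordinates on \<open>real ^ 6\<close> and the Lie algebra axioms\<close>

lemma exhaust_6: "i = 1 \<or> i = 2 \<or> i = 3 \<or> i = 4 \<or> i = 5 \<or> i = (6::6)"
proof (induct i)
  case (of_int z)
  then have "z = 0 \<or> z = 1 \<or> z = 2 \<or> z = 3 \<or> z = 4 \<or> z = 5" by auto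
  then show ?case by auto
qed

lemma forall_6: "(\<forall>i::6. P i) \<longleftrightarrow> P 1 \<and> P 2 \<and> P 3 \<and> P 4 \<and> P 5 \<and> P 6"
  by (metis exhaust_6)

lemma vec6_eq_iff:
  "v = w \<longleftrightarrow> v $ 1 = w $ 1 \<and> v $ 2 = w $ 2 \<and> v $ 3 = w $ 3 \<and> v $ 4 = w $ 4 \<and> v $ 5 = w $ 5
     \<and> v $ (6::6) = (w::'a^6) $ 6"
  by (simp only: vec_eq_iff forall_6)

lemma X_nth: "X i $ j = (if i = j then 1 else 0)"
  by (auto simp: X_def axis_def)

lemma vec6_expand:
  "v = v $ 1 *\<^sub>R X 1 + v $ 2 *\<^sub>R X 2 + v $ 3 *\<^sub>R X 3 + v $ 4 *\<^sub>R X 4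
    + v $ 5 *\<^sub>R X 5 + v $ 6 *\<^sub>R X 6"
  unfolding vec6_eq_iff by (simp add: X_nth)

lemma g6_bracket_nth:
  "g6_bracket \<mu> x y $ 1 = 0" "g6_bracket \<mu> x y $ 2 = 0"
  "g6_bracket \<mu> x y $ 3 = 0" "g6_bracket \<mu> x y $ 4 = 0"
  "g6_bracket \<mu> x y $ 5 = - (x $ 1 * y $ 2 - x $ 2 * y $ 1) - \<mu> * (x $ 1 * y $ 5 - x $ 5 * y $ 1)"
  "g6_bracket \<mu> x y $ 6 = - (x $ 1 * y $ 5 - x $ 5 * y $ 1) - (x $ 3 * y $ 4 - x $ 4 * y $ 3)"
  by (simp_all add: g6_bracket_def X_nth)

lemma lie_bracket_g6: "lie_bracket (g6_bracket \<mu>)"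
proof -
  have "bilinear (g6_bracket \<mu>)"
    unfolding bilinear_def
    by (intro conjI allI linearI; simp add: vec6_eq_iff g6_bracket_nth; simp add: algebra_simps)
  moreover have "g6_bracket \<mu> x x = 0" for x
    by (simp add: vec6_eq_iff g6_bracket_nth)
  moreover have "g6_bracket \<mu> x (g6_bracket \<mu> y z) + g6_bracket \<mu> y (g6_bracket \<mu> z x)
      + g6_bracket \<mu> z (g6_bracket \<mu> x y) = 0" for x y z
    by (simp add: vec6_eq_iff g6_bracket_nth; simp add: algebra_simps)
  ultimately show ?thesis by (simp add: lie_bracket_def)
qed

section \<open>Adapted vectors, solvability and failure of nilpotency\<close>

definition vecE :: "real \<Rightarrow> real ^ 6" where
  "vecE \<mu> = X 5 + (1 / \<mu>) *\<^sub>R X 6"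

definition vecF :: "real \<Rightarrow> real ^ 6" where
  "vecF \<mu> = X 2 - (1 / \<mu>) *\<^sub>R X 5 - (1 / \<mu>\<^sup>2) *\<^sub>R X 6"

lemma vecE_nth: "vecE \<mu> $ i = (if i = 5 then 1 else if i = 6 then 1 / \<mu> else 0)"
  by (auto simp: vecE_def X_nth)

lemma vecF_nth: "vecF \<mu> $ i = (if i = 2 then 1 else if i = 5 then - 1 / \<mu> else if i = 6 then - 1 / \<mu>\<^sup>2 else 0)"
  by (auto simp: vecF_def X_nth)

text \<open>All brackets lie in the plane of \<open>X 5\<close> and \<open>X 6\<close>, and this
  plane is abelian.\<close>

lemma lie_solvable_g6: "lie_solvable (g6_bracket \<mu>)"
proof -
  let ?br = "g6_bracket \<mu>" and ?D = "{v::real^6. v $ 1 = 0 \<and> v $ 2 = 0 \<and> v $ 3 = 0 \<and> v $ 4 = 0}"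
  have "subspace ?D" by (simp add: subspace_def)
  then have D1: "derived_series ?br 1 \<subseteq> ?D"
    unfolding One_nat_def derived_series.simps
    by (intro span_minimal) (auto simp: g6_bracket_nth)
  have "?br x y = 0" if "x \<in> derived_series ?br 1" "y \<in> derived_series ?br 1" for x y
  proof -
    have "x \<in> ?D" "y \<in> ?D" using that D1 by blast+
    then show ?thesis by (simp add: vec6_eq_iff g6_bracket_nth)
  qed
  then have "{?br x y | x y. x \<in> derived_series ?br 1 \<and> y \<in> derived_series ?br 1} \<subseteq> {0}" by auto
  then have "derived_series ?br (Suc 1) \<subseteq> {0}"
    unfolding derived_series.simps(2)[of _ 1] by (rule span_minimal) (rule subspace_single_0)
  moreover have "0 \<in> derived_series ?br (Suc 1)" by (simp add: span_zero)
  ultimately show ?thesis unfolding lie_solvable_def by blast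
qed

text \<open>An eigenvector of \<open>ad (X 1)\<close> with nonzero eigenvalue - here
  \<open>vecE \<mu>\<close>, with eigenvalue \<open>- \<mu>\<close> - survives in every term of the
  lower central series.\<close>

lemma not_lie_nilpotent_g6:
  assumes "\<mu> \<noteq> 0"
  shows "\<not> lie_nilpotent (g6_bracket \<mu>)"
proof -
  have E: "vecE \<mu> = (- 1 / \<mu>) *\<^sub>R g6_bracket \<mu> (X 1) (vecE \<mu>)"
    using assms by (simp add: vec6_eq_iff g6_bracket_nth vecE_nth X_nth)
  have "vecE \<mu> \<in> lower_central_series (g6_bracket \<mu>) m" for m
  proof (induction m)
    case (Suc m)
    then have "g6_bracket \<mu> (X 1) (vecE \<mu>) \<in> lower_central_series (g6_bracket \<mu>) (Suc m)"
      by (auto intro!: span_base)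
    then have "(- 1 / \<mu>) *\<^sub>R g6_bracket \<mu> (X 1) (vecE \<mu>) \<in> lower_central_series (g6_bracket \<mu>) (Suc m)"
      unfolding lower_central_series.simps by (rule span_scale)
    then show ?case using E by argo
  qed simp
  moreover have "vecE \<mu> \<noteq> 0" by (simp add: vec6_eq_iff vecE_nth)
  ultimately show ?thesis unfolding lie_nilpotent_def by blast
qed

section \<open>Nonexistence of symplectic structures\<close>

lemma g6_bracket_X:
  "g6_bracket \<mu> (X 1) (X 2) = - X 5" "g6_bracket \<mu> (X 1) (X 5) = - X 6 - \<mu> *\<^sub>R X 5"
  "g6_bracket \<mu> (X 3) (X 4) = - X 6"
  "g6_bracket \<mu> (X 1) (X 3) = 0" "g6_bracket \<mu> (X 1) (X 4) = 0"
  "g6_bracket \<mu> (X 2) (X 3) = 0" "g6_bracket \<mu> (X 2) (X 4) = 0"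
  "g6_bracket \<mu> (X 5) (X 3) = 0" "g6_bracket \<mu> (X 5) (X 4) = 0"
  "g6_bracket \<mu> x (X 6) = 0" "g6_bracket \<mu> (X 6) x = 0"
  by (simp_all add: vec6_eq_iff g6_bracket_nth X_nth)

lemma g6_bracket_skew: "g6_bracket \<mu> y x = - g6_bracket \<mu> x y"
  by (simp add: vec6_eq_iff g6_bracket_nth; simp add: algebra_simps)

lemma no_symplectic_structure_g6: "\<not> symplectic_structure (g6_bracket \<mu>) \<omega>"
proof
  let ?br = "g6_bracket \<mu>"
  assume "symplectic_structure ?br \<omega>"
  then have bl: "bilinear \<omega>" and skew: "\<And>x y. \<omega> x y = - \<omega> y x"
    and nd: "\<And>x. (\<And>y. \<omega> x y = 0) \<Longrightarrow> x = 0"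
    and closed: "\<And>x y z. \<omega> (?br x y) z + \<omega> (?br y z) x + \<omega> (?br z x) y = 0"
    unfolding symplectic_structure_def by blast+
  note bls = bilinear_lneg[OF bl] bilinear_lsub[OF bl] bilinear_lmul[OF bl] bilinear_lzero[OF bl]
    bilinear_radd[OF bl] bilinear_rmul[OF bl]
  note swap = g6_bracket_skew[of \<mu> "X 3" "X 1"] g6_bracket_skew[of \<mu> "X 4" "X 1"]
    g6_bracket_skew[of \<mu> "X 3" "X 2"] g6_bracket_skew[of \<mu> "X 4" "X 2"]
    g6_bracket_skew[of \<mu> "X 3" "X 5"] g6_bracket_skew[of \<mu> "X 4" "X 5"]
  note rules = g6_bracket_X swap bls
  have sq: "\<omega> (X 6) (X 6) = 0" using skew[of "X 6" "X 6"] by simp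
  \<comment> \<open>Since \<open>X 3\<close> and \<open>X 4\<close> commute with \<open>X 1\<close>,
    \<open>X 2\<close> and \<open>X 5\<close>, only the term with \<open>[X 3, X 4] = - X 6\<close>
    remains in these three instances.\<close>
  have 1: "\<omega> (X 6) (X 1) = 0" using closed[of "X 3" "X 4" "X 1"] by (simp add: rules)
  have 2: "\<omega> (X 6) (X 2) = 0" using closed[of "X 3" "X 4" "X 2"] by (simp add: rules)
  have 5: "\<omega> (X 6) (X 5) = 0" using closed[of "X 3" "X 4" "X 5"] by (simp add: rules)
  \<comment> \<open>For \<open>X 3\<close> and \<open>X 4\<close> the vector \<open>X 6\<close> is
    reached in two stages: \<open>[X 1, X 2]\<close> handles \<open>X 5\<close>, and then
    \<open>[X 1, X 5]\<close> leaves only its \<open>X 6\<close> part.\<close>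
  have "\<omega> (X 5) (X 3) = 0" using closed[of "X 1" "X 2" "X 3"] by (simp add: rules)
  then have 3: "\<omega> (X 6) (X 3) = 0" using closed[of "X 1" "X 5" "X 3"] by (simp add: rules)
  have "\<omega> (X 5) (X 4) = 0" using closed[of "X 1" "X 2" "X 4"] by (simp add: rules)
  then have 4: "\<omega> (X 6) (X 4) = 0" using closed[of "X 1" "X 5" "X 4"] by (simp add: rules)
  have "\<omega> (X 6) y = 0" for y
    by (subst vec6_expand[of y]) (simp only: bls 1 2 3 4 5 sq, simp)
  then have "X 6 = 0" by (rule nd)
  then have "X 6 $ 6 = 0" by (simp only: zero_index)
  then show False by (simp add: X_nth)
qed

section \<open>Nonexistence of complex structures\<close>

lemma no_complex_structure_g6:
  assumes "\<mu> \<noteq> 0"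
  shows "\<not> complex_structure (g6_bracket \<mu>) j"
proof
  let ?br = "g6_bracket \<mu>"
  define w where "w = j (X 6)"
  assume "complex_structure ?br j"
  then have lin: "linear j" and jj: "\<And>x. j (j x) = - x"
    and N: "\<And>x y. ?br x y + j (?br (j x) y) + j (?br x (j y)) - ?br (j x) (j y) = 0"
    unfolding complex_structure_def by blast+
  \<comment> \<open>Two of the four integrability terms vanish because \<open>X 6\<close> is
    central.\<close>
  have jw: "?br w (j y) = j (?br w y)" for y
    using N[of "X 6" y] by (simp add: g6_bracket_X w_def linear_0[OF lin])
  have no_eigenvector: "v = 0" if "j v = c *\<^sub>R v" for v c
  proof -
    have "- v = (c * c) *\<^sub>R v" using jj[of v] that linear_cmul[OF lin, of c v] by simp
    then have "(c * c + 1) *\<^sub>R v = 0" by (metis add.left_inverse scaleR_add_left scaleR_one)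
    moreover have "c * c + 1 \<noteq> 0" using zero_le_square[of c] by linarith
    ultimately show ?thesis by simp
  qed
  have central: "?br w y = 0" for y
  proof (rule ccontr)
    assume nz: "?br w y \<noteq> 0"
    define p q p' q' where "p = ?br w y $ 5" and "q = ?br w y $ 6"
      and "p' = ?br w (j y) $ 5" and "q' = ?br w (j y) $ 6"
    have v: "?br w y = p *\<^sub>R X 5 + q *\<^sub>R X 6" and v': "?br w (j y) = p' *\<^sub>R X 5 + q' *\<^sub>R X 6"
      by (simp_all add: vec6_eq_iff g6_bracket_nth X_nth p_def q_def p'_def q'_def)
    \<comment> \<open>If \<open>?br w y\<close> and its image under \<open>j\<close> were collinear,
      the former would be a real eigenvector of \<open>j\<close>.\<close>
    have det: "p * q' \<noteq> p' * q"
    proof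
      assume eq: "p * q' = p' * q"
      have "\<exists>c. j (?br w y) = c *\<^sub>R ?br w y"
      proof (cases "p = 0")
        case True
        then have "q \<noteq> 0" using nz v by auto
        with True eq have "?br w (j y) = (q' / q) *\<^sub>R ?br w y"
          unfolding v v' by simp
        then show ?thesis unfolding jw ..
      next
        case False
        with eq have "q' = (p' / p) * q" by (simp add: field_simps)
        with False have "?br w (j y) = (p' / p) *\<^sub>R ?br w y"
          unfolding v v' by (simp add: scaleR_add_right)
        then show ?thesis unfolding jw ..
      qed
      then show False using no_eigenvector nz by blast
    qed
    have e1: "p' *\<^sub>R X 5 + q' *\<^sub>R X 6 = p *\<^sub>R j (X 5) + q *\<^sub>R w"
      using jw[of y] unfolding v v' by (simp add: linear_add[OF lin] linear_cmul[OF lin] w_def)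
    have e2: "- (p *\<^sub>R X 5 + q *\<^sub>R X 6) = p' *\<^sub>R j (X 5) + q' *\<^sub>R w"
    proof -
      have "- ?br w y = j (?br w (j y))" by (simp only: jw jj)
      then show ?thesis unfolding v v' by (simp add: linear_add[OF lin] linear_cmul[OF lin] w_def)
    qed
    \<comment> \<open>Eliminating \<open>j (X 5)\<close> from \<open>e1\<close> and
      \<open>e2\<close> puts a nonzero multiple of \<open>w\<close> in the plane of
      \<open>X 5\<close> and \<open>X 6\<close>.\<close>
    have w0: "w $ i = 0" if "i \<noteq> 5" "i \<noteq> 6" for i
    proof -
      have "p * j (X 5) $ i + q * w $ i = 0" "p' * j (X 5) $ i + q' * w $ i = 0"
        using arg_cong[OF e1, of "\<lambda>u. u $ i"] arg_cong[OF e2, of "\<lambda>u. u $ i"] that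
        by (simp_all add: X_nth)
      then have "(p * q' - p' * q) * w $ i = 0" by algebra
      then show ?thesis using det by simp
    qed
    \<comment> \<open>For \<open>w\<close> in that plane, the image of \<open>ad w\<close> lies on
      the line of \<open>vecE \<mu>\<close>, which contradicts \<open>det\<close>.\<close>
    have "\<mu> * ?br w u $ 6 = ?br w u $ 5" for u
      by (simp add: g6_bracket_nth w0)
    from this[of y] this[of "j y"] have "p = \<mu> * q" "p' = \<mu> * q'"
      unfolding p_def q_def p'_def q'_def by simp_all
    then show False using det by simp
  qed
  \<comment> \<open>The centre is the line of \<open>X 6\<close>, so \<open>X 6\<close> itself
    becomes a real eigenvector of \<open>j\<close>.\<close>
  have "w = w $ 6 *\<^sub>R X 6"
    using central[of "X 1"] central[of "X 2"] central[of "X 3"] central[of "X 4"] central[of "X 5"] assms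
    by (auto simp: vec6_eq_iff g6_bracket_nth X_nth)
  then have "X 6 = 0" using no_eigenvector[of "X 6" "w $ 6"] by (simp only: w_def)
  then have "X 6 $ 6 = 0" by (simp only: zero_index)
  then show False by (simp add: X_nth)
qed

section \<open>Coordinates and brackets in the adapted basis\<close>

definition coordE :: "real \<Rightarrow> real ^ 6 \<Rightarrow> real" where
  "coordE \<mu> v = v $ 5 + v $ 2 / \<mu>"

definition coordZ :: "real \<Rightarrow> real ^ 6 \<Rightarrow> real" where
  "coordZ \<mu> v = v $ 6 - v $ 5 / \<mu>"

lemma coord_linear:
  "coordE \<mu> (v + w) = coordE \<mu> v + coordE \<mu> w" "coordZ \<mu> (v + w) = coordZ \<mu> v + coordZ \<mu> w"
  "coordE \<mu> (v - w) = coordE \<mu> v - coordE \<mu> w" "coordZ \<mu> (v - w) = coordZ \<mu> v - coordZ \<mu> w"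
  "coordE \<mu> (- v) = - coordE \<mu> v" "coordZ \<mu> (- v) = - coordZ \<mu> v"
  "coordE \<mu> (r *\<^sub>R v) = r * coordE \<mu> v" "coordZ \<mu> (r *\<^sub>R v) = r * coordZ \<mu> v"
  "coordE \<mu> 0 = 0" "coordZ \<mu> 0 = 0"
  by (simp_all add: coordE_def coordZ_def add_divide_distrib diff_divide_distrib algebra_simps)

text \<open>Up to sign, these are the differentials of the covectors dual to
  \<open>vecE \<mu>\<close> and \<open>X 6\<close>.\<close>

lemma coord_bracket:
  assumes "\<mu> \<noteq> 0"
  shows "coordE \<mu> (g6_bracket \<mu> u v) = - \<mu> * (u $ 1 * coordE \<mu> v - coordE \<mu> u * v $ 1)"
    "coordZ \<mu> (g6_bracket \<mu> u v) = (u $ 1 * v $ 2 - u $ 2 * v $ 1) / \<mu> - (u $ 3 * v $ 4 - u $ 4 * v $ 3)"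
  using assms by (simp_all add: coordE_def coordZ_def g6_bracket_nth field_simps)

lemma vec_adapted_expand:
  assumes "\<mu> \<noteq> 0"
  shows "v = v $ 1 *\<^sub>R X 1 + v $ 2 *\<^sub>R vecF \<mu> + v $ 3 *\<^sub>R X 3 + v $ 4 *\<^sub>R X 4
    + coordE \<mu> v *\<^sub>R vecE \<mu> + coordZ \<mu> v *\<^sub>R X 6"
  using assms by (simp add: vec6_eq_iff X_nth vecE_nth vecF_nth coordE_def coordZ_def power2_eq_square field_simps)

text \<open>Turns each identity in the dual sum into twelve scalar equations.\<close>

lemma dual_sum_eqI:
  fixes u v :: "(real ^ 6) dual_sum"
  assumes "\<mu> \<noteq> 0"
    and "fst u $ 1 = fst v $ 1" "fst u $ 2 = fst v $ 2" "fst u $ 3 = fst v $ 3" "fst u $ 4 = fst v $ 4"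
    and "coordE \<mu> (fst u) = coordE \<mu> (fst v)" "coordZ \<mu> (fst u) = coordZ \<mu> (fst v)"
    and "snd u (X 1) = snd v (X 1)" "snd u (vecF \<mu>) = snd v (vecF \<mu>)"
    and "snd u (X 3) = snd v (X 3)" "snd u (X 4) = snd v (X 4)"
    and "snd u (vecE \<mu>) = snd v (vecE \<mu>)" "snd u (X 6) = snd v (X 6)"
  shows "u = v"
proof (rule prod_eqI)
  show "fst u = fst v"
    by (subst (1 2) vec_adapted_expand[OF assms(1)]) (simp only: assms(2-7))
  show "snd u = snd v"
  proof (rule blinfun_eqI)
    fix w
    show "snd u w = snd v w"
      by (subst (1 2) vec_adapted_expand[OF assms(1), of w])
        (simp only: blinfun.add_right blinfun.scaleR_right assms(8-))
  qed
qed

text \<open>Serves to evaluate the covector half of the dual sum bracket on the adapted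
  basis.\<close>

lemma g6_bracket_adapted:
  assumes "\<mu> \<noteq> 0"
  shows "g6_bracket \<mu> u (X 1) = (\<mu> * coordE \<mu> u) *\<^sub>R vecE \<mu> - (u $ 2 / \<mu>) *\<^sub>R X 6"
    "g6_bracket \<mu> u (vecF \<mu>) = (u $ 1 / \<mu>) *\<^sub>R X 6"
    "g6_bracket \<mu> u (X 3) = u $ 4 *\<^sub>R X 6"
    "g6_bracket \<mu> u (X 4) = - u $ 3 *\<^sub>R X 6"
    "g6_bracket \<mu> u (vecE \<mu>) = - (\<mu> * u $ 1) *\<^sub>R vecE \<mu>"
    "g6_bracket \<mu> u (X 6) = 0"
  using assms by (simp_all add: vec6_eq_iff g6_bracket_nth X_nth vecE_nth vecF_nth coordE_def
      power2_eq_square field_simps)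

lemma blinfun_apply_ad_g6: "blinfun_apply (ad (g6_bracket \<mu>) u) v = g6_bracket \<mu> u v"
proof -
  have "linear (g6_bracket \<mu> u)"
    using lie_bracket_g6[of \<mu>] by (auto simp: lie_bracket_def bilinear_def)
  then show ?thesis
    by (simp add: ad_def bounded_linear_Blinfun_apply linear_conv_bounded_linear)
qed

lemma fst_dual_sum_bracket: "fst (dual_sum_bracket br u v) = br (fst u) (fst v)"
  by (simp add: dual_sum_bracket_def)

lemma snd_dual_sum_bracket_g6:
  "blinfun_apply (snd (dual_sum_bracket (g6_bracket \<mu>) u v)) w =
     snd u (g6_bracket \<mu> (fst v) w) - snd v (g6_bracket \<mu> (fst u) w)"
  by (simp add: dual_sum_bracket_def blinfun.diff_left blinfun_apply_ad_g6)

section \<open>The generalized complex structures\<close>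

definition adapted_vec :: "real \<Rightarrow> real \<Rightarrow> real \<Rightarrow> real \<Rightarrow> real \<Rightarrow> real \<Rightarrow> real \<Rightarrow> real ^ 6" where
  "adapted_vec \<mu> x f a b e z =
     x *\<^sub>R X 1 + f *\<^sub>R vecF \<mu> + a *\<^sub>R X 3 + b *\<^sub>R X 4 + e *\<^sub>R vecE \<mu> + z *\<^sub>R X 6"

definition adapted_covec ::
    "real \<Rightarrow> real \<Rightarrow> real \<Rightarrow> real \<Rightarrow> real \<Rightarrow> real \<Rightarrow> real \<Rightarrow> (real ^ 6) \<Rightarrow>\<^sub>L real" where
  "adapted_covec \<mu> x f a b e z =
     Blinfun (\<lambda>v. x * v $ 1 + f * v $ 2 + a * v $ 3 + b * v $ 4 + e * coordE \<mu> v + z * coordZ \<mu> v)"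

lemma adapted_vec_coord:
  assumes "\<mu> \<noteq> 0"
  shows "adapted_vec \<mu> x f a b e z $ 1 = x" "adapted_vec \<mu> x f a b e z $ 2 = f"
    "adapted_vec \<mu> x f a b e z $ 3 = a" "adapted_vec \<mu> x f a b e z $ 4 = b"
    "coordE \<mu> (adapted_vec \<mu> x f a b e z) = e" "coordZ \<mu> (adapted_vec \<mu> x f a b e z) = z"
  using assms by (simp_all add: adapted_vec_def X_nth vecE_nth vecF_nth coordE_def coordZ_def
      power2_eq_square field_simps)

lemma adapted_covec_apply:
  assumes "\<mu> \<noteq> 0"
  shows "adapted_covec \<mu> x f a b e z (X 1) = x" "adapted_covec \<mu> x f a b e z (vecF \<mu>) = f"
    "adapted_covec \<mu> x f a b e z (X 3) = a" "adapted_covec \<mu> x f a b e z (X 4) = b"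
    "adapted_covec \<mu> x f a b e z (vecE \<mu>) = e" "adapted_covec \<mu> x f a b e z (X 6) = z"
proof -
  have "linear (\<lambda>v. x * v $ 1 + f * v $ 2 + a * v $ 3 + b * v $ 4 + e * coordE \<mu> v + z * coordZ \<mu> v)"
    by (rule linearI) (simp_all add: coord_linear algebra_simps)
  then have "blinfun_apply (adapted_covec \<mu> x f a b e z) =
      (\<lambda>v. x * v $ 1 + f * v $ 2 + a * v $ 3 + b * v $ 4 + e * coordE \<mu> v + z * coordZ \<mu> v)"
    by (simp add: adapted_covec_def bounded_linear_Blinfun_apply linear_conv_bounded_linear)
  then show "adapted_covec \<mu> x f a b e z (X 1) = x" "adapted_covec \<mu> x f a b e z (vecF \<mu>) = f"
    "adapted_covec \<mu> x f a b e z (X 3) = a" "adapted_covec \<mu> x f a b e z (X 4) = b"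
    "adapted_covec \<mu> x f a b e z (vecE \<mu>) = e" "adapted_covec \<mu> x f a b e z (X 6) = z"
    using assms by (simp_all add: X_nth vecE_nth vecF_nth coordE_def coordZ_def power2_eq_square field_simps)
qed

text \<open>The planes \<open>X 3, X 4\<close> and \<open>F, Z\<close> always carry a complex and a symplectic block, respectively;
  the flag \<open>c\<close> makes the block on \<open>X 1, E\<close> complex instead of symplectic.\<close>

definition g6_gcs :: "real \<Rightarrow> bool \<Rightarrow> (real ^ 6) dual_sum \<Rightarrow> (real ^ 6) dual_sum" where
  "g6_gcs \<mu> c u = (let v = fst u; \<alpha> = blinfun_apply (snd u) in
     (adapted_vec \<mu> (if c then - coordE \<mu> v else - \<alpha> (vecE \<mu>)) (- \<alpha> (X 6)) (- v $ 4) (v $ 3)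
        (if c then v $ 1 else \<alpha> (X 1)) (\<alpha> (vecF \<mu>)),
      adapted_covec \<mu> (if c then - \<alpha> (vecE \<mu>) else - coordE \<mu> v) (- coordZ \<mu> v) (- \<alpha> (X 4)) (\<alpha> (X 3))
        (if c then \<alpha> (X 1) else v $ 1) (v $ 2)))"

text \<open>A complex block acts by \<open>j\<close> on vectors and by minus its transpose on
  covectors; a symplectic block sends vectors to covectors by contraction with the form, and
  covectors to vectors by minus the inverse.\<close>

lemma g6_gcs_coord:
  assumes "\<mu> \<noteq> 0"
  shows "fst (g6_gcs \<mu> c u) $ 1 = (if c then - coordE \<mu> (fst u) else - snd u (vecE \<mu>))"
    "fst (g6_gcs \<mu> c u) $ 2 = - snd u (X 6)"
    "fst (g6_gcs \<mu> c u) $ 3 = - fst u $ 4"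
    "fst (g6_gcs \<mu> c u) $ 4 = fst u $ 3"
    "coordE \<mu> (fst (g6_gcs \<mu> c u)) = (if c then fst u $ 1 else snd u (X 1))"
    "coordZ \<mu> (fst (g6_gcs \<mu> c u)) = snd u (vecF \<mu>)"
    "snd (g6_gcs \<mu> c u) (X 1) = (if c then - snd u (vecE \<mu>) else - coordE \<mu> (fst u))"
    "snd (g6_gcs \<mu> c u) (vecF \<mu>) = - coordZ \<mu> (fst u)"
    "snd (g6_gcs \<mu> c u) (X 3) = - snd u (X 4)"
    "snd (g6_gcs \<mu> c u) (X 4) = snd u (X 3)"
    "snd (g6_gcs \<mu> c u) (vecE \<mu>) = (if c then snd u (X 1) else fst u $ 1)"
    "snd (g6_gcs \<mu> c u) (X 6) = fst u $ 2"
  using assms by (simp_all add: g6_gcs_def Let_def adapted_vec_coord adapted_covec_apply)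

lemma blinfun_apply_adapted:
  assumes "\<mu> \<noteq> 0"
  shows "blinfun_apply \<alpha> v = v $ 1 * \<alpha> (X 1) + v $ 2 * \<alpha> (vecF \<mu>) + v $ 3 * \<alpha> (X 3) + v $ 4 * \<alpha> (X 4)
    + coordE \<mu> v * \<alpha> (vecE \<mu>) + coordZ \<mu> v * \<alpha> (X 6)"
  by (subst vec_adapted_expand[OF assms, of v]) (simp only: blinfun.add_right blinfun.scaleR_right real_scaleR_def)

lemma gen_complex_structure_g6_gcs:
  assumes "\<mu> \<noteq> 0"
  shows "gen_complex_structure (g6_bracket \<mu>) (g6_gcs \<mu> c)"
proof -
  let ?J = "g6_gcs \<mu> c" and ?B = "dual_sum_bracket (g6_bracket \<mu>)"
  note coords = g6_gcs_coord[OF assms] coord_linear blinfun.add_left blinfun.minus_left blinfun.diff_left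
    blinfun.scaleR_left blinfun.zero_left fst_dual_sum_bracket snd_dual_sum_bracket_g6
  note bracket = g6_bracket_nth(1-4) coord_bracket[OF assms] g6_bracket_adapted[OF assms]
    blinfun.add_right blinfun.minus_right blinfun.diff_right blinfun.scaleR_right blinfun.zero_right
  have "linear ?J"
    by (intro linearI; rule dual_sum_eqI[OF assms]; 
        simp only: fst_add snd_add fst_scaleR snd_scaleR coords vector_add_component
          vector_scaleR_component)
      (auto simp: algebra_simps)
  moreover have "?J (?J u) = - u" for u
    by (rule dual_sum_eqI[OF assms]) (simp_all add: coords)
  moreover have "pairing (?J u) (?J v) = pairing u v" for u v
    \<comment> \<open>Restricting the expansion to arguments \<open>fst _\<close> leaves the values
      on basis vectors intact.\<close>
    unfolding pairing_def blinfun_apply_adapted[OF assms, of _ "fst _"]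
    by (simp add: coords algebra_simps)
  moreover have "?B u v + ?J (?B (?J u) v) + ?J (?B u (?J v)) - ?B (?J u) (?J v) = 0" for u v
    by (cases c; rule dual_sum_eqI[OF assms]; simp add: coords bracket;
        use assms in \<open>simp add: field_simps\<close>)
  ultimately show ?thesis
    unfolding gen_complex_structure_def by blast
qed

section \<open>Rank of the block from the dual space to the algebra\<close>

lemma notin_span_nth:
  assumes "\<And>s. s \<in> S \<Longrightarrow> s $ i = 0" "v $ i \<noteq> 0"
  shows "v \<notin> span S"
proof -
  have "span S \<subseteq> {v. v $ i = 0}"
    using assms(1) by (intro span_minimal) (auto simp: subspace_def)
  then show ?thesis using assms(2) by auto
qed

lemma dim_adapted_leaf:
  "dim {vecF \<mu>, X 6} = 2" "dim {X 1, vecE \<mu>, vecF \<mu>, X 6} = 4"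
proof -
  have Z: "X 6 \<noteq> 0" using X_nth[of 6 6] by auto
  have F: "vecF \<mu> \<notin> span {X 6}" by (rule notin_span_nth[where i = 2]) (auto simp: X_nth vecF_nth)
  have E: "vecE \<mu> \<notin> span {vecF \<mu>, X 6}"
  proof
    assume "vecE \<mu> \<in> span {vecF \<mu>, X 6}"
    then obtain k where "vecE \<mu> - k *\<^sub>R vecF \<mu> \<in> span {X 6}" by (auto simp: span_insert)
    then obtain l where "vecE \<mu> - k *\<^sub>R vecF \<mu> = l *\<^sub>R X 6" by (auto simp: span_insert)
    \<comment> \<open>Coordinate 2 forces \<open>k = 0\<close>, after which coordinate 5 reads
      \<open>1 = 0\<close>.\<close>
    then show False
      by (auto simp: vec6_eq_iff vecE_nth vecF_nth X_nth)
  qed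
  have X1: "X 1 \<notin> span {vecE \<mu>, vecF \<mu>, X 6}"
    by (rule notin_span_nth[where i = 1]) (auto simp: X_nth vecE_nth vecF_nth)
  show "dim {vecF \<mu>, X 6} = 2" "dim {X 1, vecE \<mu>, vecF \<mu>, X 6} = 4"
    using Z F E X1 by (simp_all add: dim_insert)
qed

lemma linear_block2:
  assumes "linear J"
  shows "linear (block2 J)"
proof (rule linearI)
  fix \<alpha> \<beta> :: "'a \<Rightarrow>\<^sub>L real" and r :: real
  show "block2 J (\<alpha> + \<beta>) = block2 J \<alpha> + block2 J \<beta>"
    using linear_add[OF assms, of "(0, \<alpha>)" "(0, \<beta>)"] by (simp add: block2_def)
  show "block2 J (r *\<^sub>R \<alpha>) = r *\<^sub>R block2 J \<alpha>"
    using linear_cmul[OF assms, of r "(0, \<alpha>)"] by (simp add: block2_def)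
qed

text \<open>Complex blocks keep covectors in the dual space, so only the symplectic blocks
  contribute.\<close>

lemma range_block2_g6_gcs:
  assumes "\<mu> \<noteq> 0"
  shows "range (block2 (g6_gcs \<mu> c)) =
    span (if c then {vecF \<mu>, X 6} else {X 1, vecE \<mu>, vecF \<mu>, X 6})" (is "range ?f = span ?S")
proof
  have f: "?f \<alpha> = adapted_vec \<mu> (if c then 0 else - \<alpha> (vecE \<mu>)) (- \<alpha> (X 6)) 0 0
      (if c then 0 else \<alpha> (X 1)) (\<alpha> (vecF \<mu>))" for \<alpha>
    by (simp add: block2_def g6_gcs_def Let_def coord_linear)
  show "range ?f \<subseteq> span ?S"
    by (auto simp: f adapted_vec_def intro!: span_add span_diff span_neg span_scale intro: span_base)
  have "linear ?f"
    using gen_complex_structure_g6_gcs[OF assms, of c]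
    by (intro linear_block2) (simp add: gen_complex_structure_def)
  then have "subspace (range ?f)" by (simp add: linear_subspace_image)
  moreover have "?S \<subseteq> range ?f"
  proof -
    \<comment> \<open>The preimages are dual basis covectors, with signs read off from
      \<open>f\<close>.\<close>
    have "vecF \<mu> = ?f (adapted_covec \<mu> 0 0 0 0 0 (- 1))" "X 6 = ?f (adapted_covec \<mu> 0 1 0 0 0 0)"
      by (simp_all add: f adapted_vec_def adapted_covec_apply[OF assms])
    moreover have "X 1 = ?f (adapted_covec \<mu> 0 0 0 0 (- 1) 0)" "vecE \<mu> = ?f (adapted_covec \<mu> 1 0 0 0 0 0)"
      if "\<not> c"
      unfolding f adapted_covec_apply[OF assms] using that
      by (simp_all add: adapted_vec_def)
    ultimately show ?thesis by auto
  qed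
  ultimately show "span ?S \<subseteq> range ?f" by (rule span_minimal[rotated])
qed

theorem mainTheorem4:
  fixes \<mu> :: real
  assumes "\<mu> \<noteq> 0"
  shows "lie_bracket (g6_bracket \<mu>) \<and>
     lie_solvable (g6_bracket \<mu>) \<and> \<not> lie_nilpotent (g6_bracket \<mu>) \<and>
     (\<nexists>\<omega>. symplectic_structure (g6_bracket \<mu>) \<omega>) \<and>
     (\<nexists>j. complex_structure (g6_bracket \<mu>) j) \<and>
     (\<exists>J. gen_complex_of_type (g6_bracket \<mu>) 1 J) \<and>
     (\<exists>J. gen_complex_of_type (g6_bracket \<mu>) 2 J)"
proof -
  \<comment> \<open>With \<open>n = 3\<close>, two symplectic blocks give rank
    \<open>4 = 2 * (3 - 1)\<close> and one gives rank \<open>2 = 2 * (3 - 2)\<close>.\<close>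
  have "gen_complex_of_type (g6_bracket \<mu>) 1 (g6_gcs \<mu> False)"
    "gen_complex_of_type (g6_bracket \<mu>) 2 (g6_gcs \<mu> True)"
    unfolding gen_complex_of_type_def
    using gen_complex_structure_g6_gcs[OF assms]
    by (auto simp: range_block2_g6_gcs[OF assms] dim_adapted_leaf intro!: exI[of _ 3])
  then show ?thesis
    using lie_bracket_g6 lie_solvable_g6 not_lie_nilpotent_g6[OF assms] no_symplectic_structure_g6
      no_complex_structure_g6[OF assms] by blast
qed

end
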